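(* Write $\alpha'_j=\left(\frac{(j-1)(j+1)}{4j^2}\right)^{(j-1)/2}=2^{-(j-1)}\left(1-\frac1{j^2}\right)^{(j-1)/2}$ for odd $j$. Let $\mathrm{Th}^{k-1}_k=f_{\{k-1,k\},k}:\{-1,1\}^k\to\{0,1\}$ be the function which is $1$ exactly on vectors with at least $k-1$ coordinates equal to $1$. Then for every even $k\ge 2$, $\alpha(\mathrm{Th}^{k-1}_k)=\frac k2\,\alpha'_{k-1}$.
   Context: For $\mathbf b\in\{-1,1\}^k$, $\mathrm{wt}(\mathbf b)$ is the number of coordinates equal to $1$. For $S\subseteq[k]=\{1,\dots,k\}$, $f_{S,k}:\{-1,1\}^k\to\{0,1\}$ is given by $f_{S,k}(\mathbf x)=1$ iff $\mathrm{wt}(\mathbf x)\in S$. $\Delta_k$ is the set of symmetric probability distributions $\mathcal D$ on $\{-1,1\}^k$ (vectors of equal weight are equiprobable). $\mathrm{Bern}(p)$ is the random variable equal to $1$ with probability $p$ and $-1$ with probability $1-p$; $\odot$ is the coordinatewise product. For $\mathcal D\in\Delta_k$ and $p\in[0,1]$ define $$\lambda_S(\mathcal D,p)=\mathbb E_{\mathbf a\sim\mathcal D,\ \mathbf b\sim \mathrm{Bern}(p)^k}[f_{S,k}(\mathbf a\odot\mathbf b)],\quad \mu(\mathcal D)=\mathbb E_{\mathbf b\sim\mathcal D}[b_1],\quad \beta_S(\mathcal D)=\sup_{p\in[0,1]}\lambda_S(\mathcal D,p),\quad \gamma_S(\mathcal D)=\lambda_S(\mathcal D,1).$$ The (sketching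 approximation) ratio of $f_{S,k}$ is $$\alpha(f_{S,k})=\inf_{\mathcal D_N,\mathcal D_Y\in\Delta_k:\ \mu(\mathcal D_N)=\mu(\mathcal D_Y)}\frac{\beta_S(\mathcal D_N)}{\gamma_S(\mathcal D_Y)},$$ where the ratio is $+\infty$ if $\gamma_S(\mathcal D_Y)=0$.
   Formalization: The formal theorem covers even k ≥ 4 instead of even k ≥ 2: at k = 2 the formula gives 1, but D_N uniform on {-1,1}^2 and D_Y uniform on the vectors of weight 1 show that the ratio is at most 3/4. *)

theory Defs
  imports "HOL-Probability.Probability"
begin

text \<open>
  Vectors of \<open>{-1,1}\<^sup>k\<close> are extensional functions on the index set \<open>{1..k}\<close>, so that two vectors
  agreeing on \<open>{1..k}\<close> are equal as functions.
\<close>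

definition cube :: "nat \<Rightarrow> (nat \<Rightarrow> int) set" where
  "cube k = {1..k} \<rightarrow>\<^sub>E {-1, 1}"

definition wt :: "nat \<Rightarrow> (nat \<Rightarrow> int) \<Rightarrow> nat" where
  "wt k x = card {i \<in> {1..k}. x i = 1}"

definition cmult :: "nat \<Rightarrow> (nat \<Rightarrow> int) \<Rightarrow> (nat \<Rightarrow> int) \<Rightarrow> (nat \<Rightarrow> int)" where
  "cmult k a b = (\<lambda>i\<in>{1..k}. a i * b i)"

definition sym_fun :: "nat set \<Rightarrow> nat \<Rightarrow> (nat \<Rightarrow> int) \<Rightarrow> real" where
  "sym_fun S k x = (if wt k x \<in> S then 1 else 0)"

definition Th :: "nat \<Rightarrow> nat \<Rightarrow> (nat \<Rightarrow> int) \<Rightarrow> real" where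
  "Th t k = sym_fun {t..k} k"

definition sym_dists :: "nat \<Rightarrow> (nat \<Rightarrow> int) pmf set" where
  "sym_dists k = {D. set_pmf D \<subseteq> cube k \<and>
     (\<forall>x\<in>cube k. \<forall>y\<in>cube k. wt k x = wt k y \<longrightarrow> pmf D x = pmf D y)}"

definition Bern :: "real \<Rightarrow> int pmf" where
  "Bern p = map_pmf (\<lambda>c. if c then 1 else - 1) (bernoulli_pmf p)"

text \<open>
  The default value \<open>undefined\<close> outside of \<open>{1..k}\<close> is the one used by \<open>\<rightarrow>\<^sub>E\<close>, so
  this distribution lives on \<open>cube k\<close>.
\<close>

definition Bern_power :: "real \<Rightarrow> nat \<Rightarrow> (nat \<Rightarrow> int) pmf" where
  "Bern_power p k = Pi_pmf {1..k} undefined (\<lambda>_. Bern p)"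

text \<open>
  The quantities below take the predicate \<open>f\<close> itself as a parameter; the subscript \<open>S\<close> of
  the usual notation corresponds to \<open>f = sym_fun S k\<close>.
\<close>

definition lam :: "nat \<Rightarrow> ((nat \<Rightarrow> int) \<Rightarrow> real) \<Rightarrow> (nat \<Rightarrow> int) pmf \<Rightarrow> real \<Rightarrow> real" where
  "lam k f D p =
     measure_pmf.expectation (pair_pmf D (Bern_power p k)) (\<lambda>(a, b). f (cmult k a b))"

definition mu :: "(nat \<Rightarrow> int) pmf \<Rightarrow> real" where
  "mu D = measure_pmf.expectation D (\<lambda>b. real_of_int (b 1))"

definition beta :: "nat \<Rightarrow> ((nat \<Rightarrow> int) \<Rightarrow> real) \<Rightarrow> (nat \<Rightarrow> int) pmf \<Rightarrow> real" where
  "beta k f D = (SUP p\<in>{0..1}. lam k f D p)"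

definition gamma :: "nat \<Rightarrow> ((nat \<Rightarrow> int) \<Rightarrow> real) \<Rightarrow> (nat \<Rightarrow> int) pmf \<Rightarrow> real" where
  "gamma k f D = lam k f D 1"

definition ratio :: "nat \<Rightarrow> ((nat \<Rightarrow> int) \<Rightarrow> real) \<Rightarrow> (nat \<Rightarrow> int) pmf \<Rightarrow> (nat \<Rightarrow> int) pmf \<Rightarrow> ereal" where
  "ratio k f DN DY = (if gamma k f DY = 0 then \<infinity> else ereal (beta k f DN / gamma k f DY))"

definition alpha :: "nat \<Rightarrow> ((nat \<Rightarrow> int) \<Rightarrow> real) \<Rightarrow> ereal" where
  "alpha k f = (INF (DN, DY)\<in>{(DN, DY). DN \<in> sym_dists k \<and> DY \<in> sym_dists k \<and> mu DN = mu DY}.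
     ratio k f DN DY)"

text \<open>
  Only used for odd \<open>j\<close>, where the exponent \<open>(j - 1) / 2\<close> is a natural number. At \<open>j = 1\<close> the
  convention is \<open>0 ^ 0 = 1\<close>.
\<close>

definition alpha' :: "nat \<Rightarrow> real" where
  "alpha' j = ((real j - 1) * (real j + 1) / (4 * (real j)\<^sup>2)) ^ ((j - 1) div 2)"

lemma alpha'_alt:
  assumes "odd j"
  shows "alpha' j = (1 / 2 ^ (j - 1)) * (1 - 1 / (real j)\<^sup>2) ^ ((j - 1) div 2)"
proof -
  obtain m where j: "j = 2 * m + 1" using assms by (elim oddE)
  have "(real j - 1) * (real j + 1) / (4 * (real j)\<^sup>2) = (1 / 4) * (1 - 1 / (real j)\<^sup>2)"
  proof -
    have "real j \<noteq> 0" using j by simp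
    then show ?thesis by (simp add: divide_simps power2_eq_square) (simp add: algebra_simps)
  qed
  then have "alpha' j = (1 / 4) ^ m * (1 - 1 / (real j)\<^sup>2) ^ m"
    unfolding alpha'_def by (simp only: power_mult_distrib) (simp add: j)
  moreover have "(1 / 4 :: real) ^ m = 1 / 2 ^ (j - 1)"
    by (simp add: j power_mult power_one_over)
  ultimately show ?thesis by (simp add: j)
qed

text \<open>
  At \<open>k = 2\<close> the closed form \<open>(k / 2) * alpha' (k - 1)\<close> does not give the ratio of
  \<open>Th (k - 1) k\<close>: it evaluates to \<open>1\<close>, whereas the ratio is at most \<open>3 / 4\<close> (take \<open>DN\<close> uniform
  on the cube, \<open>DY\<close> uniform on the vectors of weight \<open>1\<close>).
\<close>

lemma cube_2: "cube 2 = (\<lambda>(u, v). (\<lambda>i\<in>{1..2}. if i = 1 then u else v)) ` ({-1, 1} \<times> {-1, 1})"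
proof -
  have "x \<in> (\<lambda>(u, v). (\<lambda>i\<in>{1..2}. if i = 1 then u else v)) ` ({-1, 1} \<times> {-1, 1})"
    if "x \<in> cube 2" for x
  proof (rule image_eqI)
    show "x = (case (x 1, x 2) of (u, v) \<Rightarrow> (\<lambda>i\<in>{1..2}. if i = 1 then u else v))"
    proof
      fix i :: nat
      consider "i = 1" | "i = 2" | "i \<notin> {1..2}" by fastforce
      then show "x i = (case (x 1, x 2) of (u, v) \<Rightarrow> (\<lambda>i\<in>{1..2}. if i = 1 then u else v)) i"
        using that unfolding cube_def by cases (auto simp: PiE_def extensional_def)
    qed
    show "(x 1, x 2) \<in> {-1, 1} \<times> {-1, 1}"
      using that unfolding cube_def by (auto simp: PiE_iff)
  qed
  moreover have "(\<lambda>(u, v). (\<lambda>i\<in>{1..2}. if i = 1 then u else v)) ` ({-1, 1} \<times> {-1, 1}) \<subseteq> cube 2"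
    by (auto simp: cube_def PiE_iff extensional_def restrict_def)
  ultimately show ?thesis by blast
qed

lemma inj_cube_2:
  "inj_on (\<lambda>(u, v). (\<lambda>i\<in>{1..2::nat}. if i = 1 then u else (v::int))) ({-1, 1} \<times> {-1, 1})"
proof (rule inj_onI, clarify)
  fix u v u' v' :: int
  assume "(\<lambda>i\<in>{1..2::nat}. if i = 1 then u else v) = (\<lambda>i\<in>{1..2}. if i = 1 then u' else v')"
  from fun_cong[OF this, of 1] fun_cong[OF this, of 2] show "u = u' \<and> v = v'" by simp
qed

lemma sum_cube_2:
  fixes g :: "(nat \<Rightarrow> int) \<Rightarrow> real"
  shows "sum g (cube 2) = (\<Sum>u\<in>{-1, 1}. \<Sum>v\<in>{-1, 1}. g (\<lambda>i\<in>{1..2}. if i = 1 then u else v))"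
  unfolding cube_2 sum.reindex[OF inj_cube_2] sum.cartesian_product
  by (simp add: case_prod_unfold)

lemma card_cube: "card (cube k) = 2 ^ k" and finite_cube: "finite (cube k)"
  by (auto simp: cube_def card_PiE finite_PiE numeral_2_eq_2)

lemma wt_2: "wt 2 x = (if x 1 = 1 then 1 else 0) + (if x 2 = 1 then 1 else 0)"
proof -
  have "{i \<in> {1..2::nat}. x i = 1} = (if x 1 = 1 then {1} else {}) \<union> (if x 2 = 1 then {2} else {})"
    by (auto simp: le_Suc_eq numeral_2_eq_2)
  then show ?thesis by (simp add: wt_def)
qed

lemma set_Bern_power: "set_pmf (Bern_power p k) \<subseteq> cube k"
  unfolding Bern_power_def cube_def
  by (subst set_Pi_pmf) (auto simp: PiE_dflt_def PiE_def extensional_def Bern_def)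

lemma uniform_sym:
  assumes "A \<noteq> {}" "A = {x \<in> cube k. wt k x \<in> W}"
  shows "pmf_of_set A \<in> sym_dists k"
proof -
  have "finite A" using assms finite_cube by auto
  then show ?thesis using assms by (auto simp: sym_dists_def indicator_def)
qed

lemma lam_uniform_2: "lam 2 (Th 1 2) (pmf_of_set (cube 2)) p = 3 / 4"
proof -
  have ne: "cube 2 \<noteq> {}" by (auto simp: cube_2)
  have "measure_pmf.expectation (pmf_of_set (cube 2)) (\<lambda>a. Th 1 2 (cmult 2 a b)) = 3 / 4"
    if "b \<in> cube 2" for b
  proof -
    have "b 1 \<in> {-1, 1}" "b 2 \<in> {-1, 1}" using that unfolding cube_def by (auto simp: PiE_iff)
    then show ?thesis
      unfolding integral_pmf_of_set[OF ne finite_cube] card_cube sum_cube_2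
      by (auto simp: Th_def sym_fun_def wt_2 cmult_def)
  qed
  then have inner: "measure_pmf.expectation (pmf_of_set (cube 2)) (\<lambda>a. Th 1 2 (cmult 2 a b)) = 3 / 4"
    if "b \<in> set_pmf (Bern_power p 2)" for b using that set_Bern_power by blast
  have fin: "finite (set_pmf (Bern_power p 2))"
    using set_Bern_power finite_cube by (rule finite_subset)
  have "lam 2 (Th 1 2) (pmf_of_set (cube 2)) p =
      measure_pmf.expectation (pair_pmf (Bern_power p 2) (pmf_of_set (cube 2)))
        (\<lambda>(b, a). Th 1 2 (cmult 2 a b))"
    unfolding lam_def by (subst pair_commute_pmf) (simp add: case_prod_unfold)
  also have "\<dots> = (\<Sum>b\<in>set_pmf (Bern_power p 2). pmf (Bern_power p 2) b * (3 / 4))"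
    unfolding pair_pmf_def
    by (subst pmf_expectation_bind[where A = "set_pmf (Bern_power p 2)"])
       (use fin ne finite_cube in \<open>auto simp: bind_return_pmf' map_pmf_def[symmetric] inner[simplified] intro!: sum.cong\<close>)
  also have "\<dots> = 3 / 4"
    using sum_pmf_eq_1[OF fin, of "Bern_power p 2"] by (simp only: sum_distrib_right[symmetric])
  finally show ?thesis .
qed

lemma alpha_Th_1_2: "alpha 2 (Th 1 2) \<le> ereal (3 / 4)"
  and closed_form_fails_at_2: "alpha 2 (Th 1 2) \<noteq> ereal (real 2 / 2 * alpha' 1)"
proof -
  define DN where "DN = pmf_of_set (cube 2)"
  define A where "A = {x \<in> cube 2. wt 2 x \<in> {1}}"
  have A: "finite A" "A \<noteq> {}" 
  proof -
    show "finite A" using finite_cube by (simp add: A_def)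
    have "(\<lambda>i\<in>{1..2}. if i = 1 then 1 else -1) \<in> A" by (auto simp: A_def cube_def wt_2)
    then show "A \<noteq> {}" by blast
  qed
  have ne: "cube 2 \<noteq> {}" using A by (auto simp: A_def)
  have N: "DN \<in> sym_dists 2" unfolding DN_def by (rule uniform_sym[OF ne, of _ UNIV]) simp
  have Y: "pmf_of_set A \<in> sym_dists 2" by (rule uniform_sym[OF A(2) A_def])
  have muN: "mu DN = 0"
    unfolding mu_def DN_def integral_pmf_of_set[OF ne finite_cube] sum_cube_2 by simp
  have "(\<Sum>x\<in>A. real_of_int (x 1)) = (\<Sum>x\<in>cube 2. if wt 2 x \<in> {1} then real_of_int (x 1) else 0)"
    unfolding A_def by (rule sum.inter_filter[OF finite_cube])
  also have "\<dots> = 0" unfolding sum_cube_2 by (simp add: wt_2)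
  finally have muY: "mu (pmf_of_set A) = 0" unfolding mu_def integral_pmf_of_set[OF A(2,1)] by simp
  have "beta 2 (Th 1 2) DN = 3 / 4" unfolding beta_def DN_def lam_uniform_2 by simp
  moreover have "gamma 2 (Th 1 2) (pmf_of_set A) = 1"
  proof -
    have "set_pmf (bernoulli_pmf 1) \<subseteq> {True}"
    proof
      fix c assume "c \<in> set_pmf (bernoulli_pmf 1)"
      then show "c \<in> {True}" by (cases c) (auto simp: set_pmf_iff)
    qed
    then have "set_pmf (Bern 1) \<subseteq> {1}" by (auto simp: Bern_def)
    then have one: "b 1 = 1 \<and> b 2 = 1" if "b \<in> set_pmf (Bern_power 1 2)" for b
    proof -
      have "b \<in> PiE_dflt {1..2} undefined (\<lambda>_. set_pmf (Bern 1))"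
        using that by (simp add: Bern_power_def set_Pi_pmf)
      then have "b 1 \<in> set_pmf (Bern 1)" "b 2 \<in> set_pmf (Bern 1)"
        by (auto simp: PiE_dflt_def)
      with \<open>set_pmf (Bern 1) \<subseteq> {1}\<close> show ?thesis by blast
    qed
    have "gamma 2 (Th 1 2) (pmf_of_set A) =
        measure_pmf.expectation (pair_pmf (pmf_of_set A) (Bern_power 1 2)) (\<lambda>_. 1)"
      unfolding gamma_def lam_def
    proof (intro integral_cong_AE)
      have "Th 1 2 (cmult 2 a b) = 1" if "a \<in> A" "b \<in> set_pmf (Bern_power 1 2)" for a b
      proof -
        have "wt 2 (cmult 2 a b) = wt 2 a"
          using one[OF that(2)] by (simp add: wt_2 cmult_def)
        also have "\<dots> = 1" using that(1) by (simp add: A_def)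
        finally show ?thesis by (simp add: Th_def sym_fun_def)
      qed
      then show "AE x in measure_pmf (pair_pmf (pmf_of_set A) (Bern_power 1 2)).
          (case x of (a, b) \<Rightarrow> Th 1 2 (cmult 2 a b)) = 1"
        using A by (auto simp: AE_measure_pmf_iff)
    qed simp_all
    then show ?thesis by simp
  qed
  ultimately have "ratio 2 (Th 1 2) DN (pmf_of_set A) = ereal (3 / 4)" by (simp add: ratio_def)
  moreover have "alpha 2 (Th 1 2) \<le> ratio 2 (Th 1 2) DN (pmf_of_set A)"
    unfolding alpha_def
    by (rule INF_lower2[of "(DN, pmf_of_set A)"]) (use N Y muN muY in auto)
  ultimately show le: "alpha 2 (Th 1 2) \<le> ereal (3 / 4)" by simp
  show "alpha 2 (Th 1 2) \<noteq> ereal (real 2 / 2 * alpha' 1)"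
  proof
    assume "alpha 2 (Th 1 2) = ereal (real 2 / 2 * alpha' 1)"
    with le show False by (simp add: alpha'_def)
  qed
qed

end

theory Submission
  imports Defs
begin

text \<open>
  Write \<open>k = 2 m\<close> and \<open>n = k - 1\<close>. If \<open>a\<close> has weight \<open>i\<close>, then \<open>a \<odot> b\<close> has weight at least \<open>k - 1\<close>
  with probability \<open>accept k i p\<close>, so everything depends only on the distribution of the weight.
  Since \<open>\<mu>\<close> determines the expected weight and \<open>n \<gamma> \<le> E wt\<close> by Markov's inequality, the lower bound
  follows from the pointwise estimate \<open>accept k i (m / n) \<ge> \<alpha> i / n\<close>, an equality at the weights
  \<open>m\<close> and \<open>m + 1\<close>. For the upper bound, \<open>D\<^sub>N\<close> mixes these two layers in the proportion that makes
  \<open>p = m / n\<close> a critical point of \<open>\<lambda>(D\<^sub>N, p)\<close>; it is then the global maximum. \<open>D\<^sub>Y\<close> mixes the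
  layers \<open>k - 1\<close> and \<open>0\<close>, for which Markov's inequality is an equality.
\<close>

section \<open>Acceptance probability as a function of the weight\<close>

definition accept :: "nat \<Rightarrow> nat \<Rightarrow> real \<Rightarrow> real" where
  "accept k i p = p ^ i * (1 - p) ^ (k - i) + real i * p ^ (i - 1) * (1 - p) ^ (k - i + 1) +
     real (k - i) * p ^ (i + 1) * (1 - p) ^ (k - i - 1)"

lemma wt_le: "wt k a \<le> k"
proof -
  have "card {i \<in> {1..k}. a i = 1} \<le> card {1..k}" by (rule card_mono) auto
  then show ?thesis by (simp add: wt_def)
qed

lemma pmf_Bern: "0 \<le> p \<Longrightarrow> p \<le> 1 \<Longrightarrow> pmf (Bern p) 1 = p"
  "0 \<le> p \<Longrightarrow> p \<le> 1 \<Longrightarrow> pmf (Bern p) (- 1) = 1 - p"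
proof -
  have inj: "inj (\<lambda>c. if c then 1 else - 1 :: int)" by (auto simp: inj_def)
  show "0 \<le> p \<Longrightarrow> p \<le> 1 \<Longrightarrow> pmf (Bern p) 1 = p"
    using pmf_map_inj'[OF inj, of "bernoulli_pmf p" True] by (simp add: Bern_def)
  show "0 \<le> p \<Longrightarrow> p \<le> 1 \<Longrightarrow> pmf (Bern p) (- 1) = 1 - p"
    using pmf_map_inj'[OF inj, of "bernoulli_pmf p" False] by (simp add: Bern_def)
qed

lemma cube_coordinate: "b \<in> cube k \<Longrightarrow> i \<in> {1..k} \<Longrightarrow> b i = 1 \<or> b i = - 1"
  by (auto simp: cube_def PiE_iff)

lemma card_coordinates_ne_1: "card ({1..k} \<inter> - {i. a i = 1}) = k - wt k a"
proof -
  have eq: "{1..k} \<inter> - {i. a i = 1} = {1..k} - {i\<in>{1..k}. a i = 1}" by auto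
  have fin: "finite {i\<in>{1..k}. a i = 1}" and sub: "{i\<in>{1..k}. a i = 1} \<subseteq> {1..k}" by auto
  show ?thesis unfolding eq wt_def card_Diff_subset[OF fin sub] by simp
qed

lemma card_coordinates_eq_1: "card ({1..k} \<inter> {i. a i = 1}) = wt k a"
  unfolding wt_def by (rule arg_cong[where f = card]) auto

lemma sum_coordinates:
  fixes X Y :: real
  shows "(\<Sum>j\<in>{1..k}. if a j = 1 then X else Y) = real (wt k a) * X + real (k - wt k a) * Y"
  by (simp only: sum.If_cases finite_atLeastAtMost sum_constant card_coordinates_eq_1 card_coordinates_ne_1)

lemma pmf_Bern_power:
  assumes "0 \<le> p" "p \<le> 1" "b \<in> cube k"
  shows "pmf (Bern_power p k) b = p ^ wt k b * (1 - p) ^ (k - wt k b)"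
proof -
  \<comment> \<open>Off the index set a cube vector equals the default value of
    \<open>Pi_pmf\<close>; a vector violating this would have mass zero.\<close>
  have "\<forall>x. x \<notin> {1..k} \<longrightarrow> b x = undefined"
    using assms(3) by (auto simp: cube_def PiE_iff extensional_def)
  then have "pmf (Bern_power p k) b = (\<Prod>i\<in>{1..k}. pmf (Bern p) (b i))"
    unfolding Bern_power_def by (subst pmf_Pi) auto
  also have "\<dots> = (\<Prod>i\<in>{1..k}. if b i = 1 then p else 1 - p)"
  proof (rule prod.cong)
    fix i assume "i \<in> {1..k}"
    from cube_coordinate[OF assms(3) this] show "pmf (Bern p) (b i) = (if b i = 1 then p else 1 - p)"
      using pmf_Bern[OF assms(1,2)] by auto
  qed simp
  also have "\<dots> = p ^ wt k b * (1 - p) ^ (k - wt k b)"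
    by (simp only: prod.If_cases finite_atLeastAtMost prod_constant card_coordinates_eq_1 card_coordinates_ne_1)
  finally show ?thesis .
qed

lemma flip_in_cube: "a \<in> cube k \<Longrightarrow> j \<in> {1..k} \<Longrightarrow> a(j := - a j) \<in> cube k"
  using cube_coordinate[of a k j] by (auto simp: cube_def PiE_iff extensional_def)

lemma wt_flip:
  assumes "a \<in> cube k" "j \<in> {1..k}"
  shows "wt k (a(j := - a j)) = (if a j = 1 then wt k a - 1 else wt k a + 1)"
proof (cases "a j = 1")
  case True
  then have "{i\<in>{1..k}. (a(j := - a j)) i = 1} = {i\<in>{1..k}. a i = 1} - {j}" by auto
  then show ?thesis using True assms(2) by (simp add: wt_def)
next
  case False
  then have "{i\<in>{1..k}. (a(j := - a j)) i = 1} = insert j {i\<in>{1..k}. a i = 1}"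
    using assms cube_coordinate[OF assms] by auto
  then show ?thesis using False by (simp add: wt_def)
qed

text \<open>A coordinate of the product is 1 exactly where \<open>a\<close> and \<open>b\<close>
  agree, so its weight is \<open>k\<close> minus the number of disagreements, collected in
  \<open>M b\<close>. Weight at least \<open>k - 1\<close> therefore means at most one
  disagreement.\<close>

lemma near_agreement:
  assumes "a \<in> cube k"
  shows "{b \<in> cube k. wt k (cmult k a b) \<in> {k - 1..k}} = insert a ((\<lambda>j. a(j := - a j)) ` {1..k})"
proof -
  define M where "M b = {i\<in>{1..k}. b i \<noteq> a i}" for b
  have wt: "wt k (cmult k a b) = k - card (M b)" if "b \<in> cube k" for b
  proof -
    have "a i * b i = 1 \<longleftrightarrow> b i = a i" if "i \<in> {1..k}" for i
      using cube_coordinate[OF assms that] cube_coordinate[OF \<open>b \<in> cube k\<close> that] by auto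
    then have "{i\<in>{1..k}. cmult k a b i = 1} = {1..k} - M b" by (auto simp: cmult_def M_def)
    moreover have "finite (M b)" "M b \<subseteq> {1..k}" by (auto simp: M_def)
    ultimately show ?thesis unfolding wt_def by (simp add: card_Diff_subset)
  qed
  have le: "card (M b) \<le> k" for b
  proof -
    have "M b \<subseteq> {1..k}" by (auto simp: M_def)
    from card_mono[OF _ this] show ?thesis by simp
  qed
  \<comment> \<open>Both vectors are \<open>undefined\<close> here, so agreement on the index set
    gives equality as functions.\<close>
  have out: "b i = a i" if "b \<in> cube k" "i \<notin> {1..k}" for b i
  proof -
    have "b i = undefined" "a i = undefined"
      using that assms by (auto simp: cube_def PiE_iff extensional_def)
    then show ?thesis by simp
  qed
  show ?thesis
  proof (intro equalityI subsetI)
    fix b assume "b \<in> {b \<in> cube k. wt k (cmult k a b) \<in> {k - 1..k}}"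
    then have b: "b \<in> cube k" and "k - card (M b) \<ge> k - 1" using wt by auto
    then have "card (M b) = 0 \<or> card (M b) = 1" using le[of b] by linarith
    moreover have "finite (M b)" by (simp add: M_def)
    ultimately consider "M b = {}" | j where "M b = {j}" by (auto simp: card_1_singleton_iff)
    then show "b \<in> insert a ((\<lambda>j. a(j := - a j)) ` {1..k})"
    proof cases
      case 1
      have "b i = a i" for i
        using 1 out[OF b, of i] unfolding M_def by blast
      then have "b = a" by (rule ext)
      then show ?thesis by simp
    next
      case 2
      then have j: "j \<in> {1..k}" "b j \<noteq> a j" by (auto simp: M_def)
      then have bj: "b j = - a j" using cube_coordinate[OF assms j(1)] cube_coordinate[OF b j(1)] by auto
      have "b i = a i" if "i \<noteq> j" for i
        using 2 out[OF b, of i] that unfolding M_def by blast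
      with bj have "b = a(j := - a j)" by (simp add: fun_eq_iff)
      then show ?thesis using j by blast
    qed
  next
    fix b assume "b \<in> insert a ((\<lambda>j. a(j := - a j)) ` {1..k})"
    then consider "b = a" | j where "j \<in> {1..k}" "b = a(j := - a j)" by auto
    then show "b \<in> {b \<in> cube k. wt k (cmult k a b) \<in> {k - 1..k}}"
    proof cases
      case 1
      then have "M b = {}" by (auto simp: M_def)
      then show ?thesis using wt[of b] 1 assms by simp
    next
      case 2
      then have "M b \<subseteq> {j}" by (auto simp: M_def)
      then have "card (M b) \<le> 1" using card_mono[of "{j}" "M b"] by simp
      then show ?thesis using wt[of b] flip_in_cube[OF assms 2(1)] 2 by auto
    qed
  qed
qed

text \<open>The accepted vectors are \<open>a\<close> itself, its flips at a 1 and its flips at a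
  -1. These have weight \<open>?w\<close>, \<open>?w - 1\<close> and \<open>?w + 1\<close>, and they
  account for the three terms of \<open>accept\<close> in this order.\<close>

lemma sum_near_agreement:
  assumes "a \<in> cube k" "0 \<le> p" "p \<le> 1"
  shows "(\<Sum>b\<in>cube k. Th (k - 1) k (cmult k a b) * pmf (Bern_power p k) b) = accept k (wt k a) p"
proof -
  let ?fl = "\<lambda>j. a(j := - a j)" and ?w = "wt k a"
  have ne: "?fl j \<noteq> a" if "j \<in> {1..k}" for j
    using cube_coordinate[OF assms(1) that] by (auto dest: fun_cong[of _ _ j])
  have inj: "inj_on ?fl {1..k}"
  proof (rule inj_onI, rule ccontr)
    fix i j assume ij: "i \<in> {1..k}" "?fl i = ?fl j" "i \<noteq> j"
    from fun_cong[OF ij(2), of i] ij(3) have "- a i = a i" by simp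
    then show False using cube_coordinate[OF assms(1) ij(1)] by auto
  qed
  have "(\<Sum>b\<in>cube k. Th (k - 1) k (cmult k a b) * pmf (Bern_power p k) b)
     = (\<Sum>b\<in>{b \<in> cube k. wt k (cmult k a b) \<in> {k - 1..k}}. pmf (Bern_power p k) b)"
    unfolding sum.inter_filter[OF finite_cube]
    by (intro sum.cong) (auto simp: Th_def sym_fun_def)
  also have "\<dots> = pmf (Bern_power p k) a + (\<Sum>j\<in>{1..k}. pmf (Bern_power p k) (?fl j))"
    unfolding near_agreement[OF assms(1)]
  proof -
    have "a \<notin> ?fl ` {1..k}"
    proof
      assume "a \<in> ?fl ` {1..k}"
      then obtain j where j: "a = ?fl j" "j \<in> {1..k}" by (rule imageE)
      show False by (rule notE[OF ne[OF j(2)] j(1)[symmetric]])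
    qed
    then show "sum (pmf (Bern_power p k)) (insert a (?fl ` {1..k}))
        = pmf (Bern_power p k) a + (\<Sum>j\<in>{1..k}. pmf (Bern_power p k) (?fl j))"
      using sum.reindex[OF inj, of "pmf (Bern_power p k)"] by simp
  qed
  also have "(\<Sum>j\<in>{1..k}. pmf (Bern_power p k) (?fl j))
     = (\<Sum>j\<in>{1..k}. if a j = 1 then p ^ (?w - 1) * (1 - p) ^ (k - ?w + 1)
                      else p ^ (?w + 1) * (1 - p) ^ (k - ?w - 1))"
  proof (rule sum.cong)
    fix j assume j: "j \<in> {1..k}"
    \<comment> \<open>This makes the subtraction in \<open>?w - 1\<close> exact. At weight 0 there
      is no 1 to flip, and the corresponding term of \<open>accept\<close> has the factor 0.\<close>
    have "?w \<ge> 1" if "a j = 1"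
    proof -
      have "{j} \<subseteq> {i\<in>{1..k}. a i = 1}" using that j by auto
      from card_mono[OF _ this] show ?thesis by (simp add: wt_def)
    qed
    then show "pmf (Bern_power p k) (?fl j) = (if a j = 1 then p ^ (?w - 1) * (1 - p) ^ (k - ?w + 1)
                      else p ^ (?w + 1) * (1 - p) ^ (k - ?w - 1))"
      using wt_le[of k a]
      by (auto simp: pmf_Bern_power[OF assms(2,3) flip_in_cube[OF assms(1) j]]
          wt_flip[OF assms(1) j] Suc_diff_le)
  qed simp
  finally show ?thesis
    unfolding sum_coordinates pmf_Bern_power[OF assms(2,3,1)] accept_def by (simp add: mult.assoc)
qed

lemma expectation_cube:
  fixes f :: "(nat \<Rightarrow> int) \<Rightarrow> real"
  assumes "set_pmf D \<subseteq> cube k"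
  shows "measure_pmf.expectation D f = (\<Sum>a\<in>cube k. f a * pmf D a)"
  by (rule integral_measure_pmf_real) (use assms finite_cube in auto)

text \<open>Since \<open>a\<close> and \<open>b\<close> are independent, the sum over
  \<open>b\<close> can be carried out first, for each fixed \<open>a\<close>.\<close>

lemma lam_Th:
  assumes "set_pmf D \<subseteq> cube k" "0 \<le> p" "p \<le> 1"
  shows "lam k (Th (k - 1) k) D p = measure_pmf.expectation D (\<lambda>a. accept k (wt k a) p)"
proof -
  have "lam k (Th (k - 1) k) D p = (\<Sum>(a, b)\<in>cube k \<times> cube k.
      Th (k - 1) k (cmult k a b) * (pmf D a * pmf (Bern_power p k) b))"
    unfolding lam_def
    by (subst integral_measure_pmf_real[where A = "cube k \<times> cube k"])
       (use assms(1) set_Bern_power[of p k] in \<open>auto simp: finite_cube case_prod_unfold pmf_pair intro!: sum.cong\<close>)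
  also have "\<dots> = (\<Sum>a\<in>cube k. (\<Sum>b\<in>cube k. Th (k - 1) k (cmult k a b) * pmf (Bern_power p k) b) * pmf D a)"
    by (simp add: sum.cartesian_product[symmetric] sum_distrib_left mult_ac)
  also have "\<dots> = (\<Sum>a\<in>cube k. accept k (wt k a) p * pmf D a)"
    by (intro sum.cong refl) (simp only: sum_near_agreement[OF _ assms(2,3)])
  also have "\<dots> = measure_pmf.expectation D (\<lambda>a. accept k (wt k a) p)"
    by (rule expectation_cube[OF assms(1), symmetric])
  finally show ?thesis .
qed

text \<open>By \<open>0 ^ 0 = 1\<close>, the first term survives only at \<open>i = k\<close> and
  the third only at \<open>i = k - 1\<close>; at \<open>i = k\<close> the third also has exponent 0,
  but its factor \<open>real (k - i)\<close> vanishes.\<close>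

lemma accept_1: "0 < k \<Longrightarrow> i \<le> k \<Longrightarrow> accept k i 1 = (if k - 1 \<le> i then 1 else 0)"
  by (cases "i = k"; cases "i = k - 1") (auto simp: accept_def power_0_left)

section \<open>Symmetry: \<open>mu\<close> and the expected weight\<close>

lemma transpose_cube:
  assumes "x \<in> cube k" "i \<in> {1..k}" "j \<in> {1..k}"
  shows "x \<circ> Transposition.transpose i j \<in> cube k" "wt k (x \<circ> Transposition.transpose i j) = wt k x"
proof -
  have t: "Transposition.transpose i j l \<in> {1..k} \<longleftrightarrow> l \<in> {1..k}" for l
    using assms(2,3) by (auto simp: Transposition.transpose_def)
  show "x \<circ> Transposition.transpose i j \<in> cube k"
    using assms(1) t by (auto simp: cube_def PiE_iff extensional_def simp del: atLeastAtMost_iff)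
  have "{l \<in> {1..k}. (x \<circ> Transposition.transpose i j) l = 1} = Transposition.transpose i j ` {l \<in> {1..k}. x l = 1}"
    (is "?L = ?R")
  proof (intro equalityI subsetI)
    fix l assume "l \<in> ?L"
    then have "Transposition.transpose i j l \<in> {l \<in> {1..k}. x l = 1}" using t[of l] by (simp del: atLeastAtMost_iff)
    then have "Transposition.transpose i j (Transposition.transpose i j l) \<in> ?R" by (rule imageI)
    then show "l \<in> ?R" by simp
  next
    fix l assume "l \<in> ?R"
    then show "l \<in> ?L" using t by (auto simp del: atLeastAtMost_iff)
  qed
  then show "wt k (x \<circ> Transposition.transpose i j) = wt k x"
    unfolding wt_def by (simp only: card_image[OF inj_on_subset[OF inj_transpose subset_UNIV]])
qed

text \<open>By symmetry every coordinate has the mean of coordinate 1, and the coordinates of a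
  vector sum to twice its weight minus \<open>k\<close>. Hence the constraint on \<open>mu\<close>
  is a constraint on expected weights.\<close>

lemma mu_eq:
  assumes "D \<in> sym_dists k" "0 < k"
  shows "real k * mu D = 2 * measure_pmf.expectation D (\<lambda>a. real (wt k a)) - real k"
proof -
  have sub: "set_pmf D \<subseteq> cube k" using assms(1) by (simp add: sym_dists_def)
  note E = expectation_cube[OF sub]
  have coord: "(\<Sum>a\<in>cube k. real_of_int (a j) * pmf D a) = mu D" if "j \<in> {1..k}" for j
  proof -
    have "(\<Sum>a\<in>cube k. real_of_int (a j) * pmf D a) = (\<Sum>a\<in>cube k. real_of_int (a 1) * pmf D a)"
    \<comment> \<open>Swapping coordinates 1 and \<open>j\<close> is an involution of the cube that
      keeps the weight, and so keeps the mass under \<open>D\<close>.\<close>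
    proof (rule sum.reindex_bij_witness[where i = "\<lambda>a. a \<circ> Transposition.transpose 1 j" and j = "\<lambda>a. a \<circ> Transposition.transpose 1 j"])
      fix a assume a: "a \<in> cube k"
      have 1: "1 \<in> {1..k}" using assms(2) by simp
      note s = transpose_cube[OF a 1 that]
      show "a \<circ> Transposition.transpose 1 j \<in> cube k" "a \<circ> Transposition.transpose 1 j \<in> cube k" by (rule s)+
      show "a \<circ> Transposition.transpose 1 j \<circ> Transposition.transpose 1 j = a" "a \<circ> Transposition.transpose 1 j \<circ> Transposition.transpose 1 j = a"
        by (simp_all add: fun_eq_iff)
      have "pmf D (a \<circ> Transposition.transpose 1 j) = pmf D a"
        using assms(1) s a unfolding sym_dists_def by blast
      then show "real_of_int ((a \<circ> Transposition.transpose 1 j) 1) * pmf D (a \<circ> Transposition.transpose 1 j) = real_of_int (a j) * pmf D a"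
        by (simp only: o_apply transpose_apply_first)
    qed
    then show ?thesis by (simp add: mu_def E)
  qed
  have "real k * mu D = (\<Sum>j\<in>{1..k}. \<Sum>a\<in>cube k. real_of_int (a j) * pmf D a)"
    by (simp add: coord)
  also have "\<dots> = (\<Sum>a\<in>cube k. (\<Sum>j\<in>{1..k}. real_of_int (a j)) * pmf D a)"
    by (subst sum.swap) (simp add: sum_distrib_right)
  also have "\<dots> = (\<Sum>a\<in>cube k. 2 * (real (wt k a) * pmf D a) - real k * pmf D a)"
  proof (rule sum.cong)
    fix a assume a: "a \<in> cube k"
    have "(\<Sum>j\<in>{1..k}. real_of_int (a j)) = (\<Sum>j\<in>{1..k}. if a j = 1 then 1 else - 1)"
      by (rule sum.cong) (use cube_coordinate[OF a] in fastforce)+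
    also have "\<dots> = 2 * real (wt k a) - real k"
      unfolding sum_coordinates using wt_le[of k a] by (simp add: of_nat_diff)
    finally have "(\<Sum>j\<in>{1..k}. real_of_int (a j)) = 2 * real (wt k a) - real k" .
    then show "(\<Sum>j\<in>{1..k}. real_of_int (a j)) * pmf D a = 2 * (real (wt k a) * pmf D a) - real k * pmf D a"
      by (simp only: left_diff_distrib mult.assoc)
  qed simp
  also have "\<dots> = 2 * (\<Sum>a\<in>cube k. real (wt k a) * pmf D a) - real k * (\<Sum>a\<in>cube k. pmf D a)"
    by (simp add: sum_subtractf sum_distrib_left)
  also have "(\<Sum>a\<in>cube k. pmf D a) = 1" by (rule sum_pmf_eq_1[OF finite_cube sub])
  finally show ?thesis by (simp add: E)
qed

section \<open>The pointwise estimate at \<open>p = m / n\<close>\<close>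

text \<open>The case \<open>i = m + d\<close> of \<open>weight_ineq\<close> after cancelling common
  powers. In the induction step the two sides of \<open>step\<close> differ by
  \<open>x * (m\<^sup>2 - m - x - 1)\<close>; this is 0 for \<open>x = 0\<close>, which is why
  weight \<open>m + 1\<close> is tight as well as weight \<open>m\<close>.\<close>

lemma weight_ineq_above:
  fixes m :: real
  assumes "m \<ge> 2" "real d \<le> m"
  shows "(m - 1) ^ d * (m * (m + real d)) \<le> m ^ d * (m\<^sup>2 - real d)"
  using assms(2)
proof (induction d)
  case 0
  then show ?case by (simp add: power2_eq_square)
next
  case (Suc d)
  define x where "x = real d"
  have x: "0 \<le> x" "x \<le> m - 1" using Suc.prems by (auto simp: x_def)
  have IH: "(m - 1) ^ d * (m * (m + x)) \<le> m ^ d * (m\<^sup>2 - x)" using Suc by (simp add: x_def)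
  have "0 \<le> x * (m\<^sup>2 - m - x - 1)"
  proof (rule mult_nonneg_nonneg)
    have "m * 2 \<le> m * m" by (rule mult_left_mono) (use assms in auto)
    then show "0 \<le> m\<^sup>2 - m - x - 1" using x unfolding power2_eq_square by linarith
  qed (use x in simp)
  then have step: "(m - 1) * (m + x + 1) * (m\<^sup>2 - x) \<le> m * (m\<^sup>2 - x - 1) * (m + x)"
    by (simp add: power2_eq_square algebra_simps)
  have "(m + x) * ((m - 1) ^ Suc d * (m * (m + x + 1)))
      = ((m - 1) * (m + x + 1)) * ((m - 1) ^ d * (m * (m + x)))" by simp
  also have "\<dots> \<le> ((m - 1) * (m + x + 1)) * (m ^ d * (m\<^sup>2 - x))"
    by (rule mult_left_mono[OF IH]) (use x assms in auto)
  also have "\<dots> = m ^ d * ((m - 1) * (m + x + 1) * (m\<^sup>2 - x))" by simp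
  also have "\<dots> \<le> m ^ d * (m * (m\<^sup>2 - x - 1) * (m + x))"
    by (rule mult_left_mono[OF step]) (use assms in auto)
  also have "\<dots> = (m + x) * (m ^ Suc d * (m\<^sup>2 - x - 1))" by simp
  finally have "(m - 1) ^ Suc d * (m * (m + x + 1)) \<le> m ^ Suc d * (m\<^sup>2 - x - 1)"
    using x assms by simp
  then show ?case by (simp add: x_def algebra_simps)
qed

text \<open>The case \<open>i = m - e\<close>. Here the two sides of \<open>step\<close> differ by
  \<open>(x + 1) * (m\<^sup>2 - m + x)\<close>, and the cancelled factor \<open>m - x\<close> is
  positive because \<open>x \<le> m - 1\<close>.\<close>

lemma weight_ineq_below:
  fixes m :: real
  assumes "m \<ge> 2" "real e \<le> m"
  shows "m ^ e * (m * (m - real e)) \<le> (m - 1) ^ e * (m\<^sup>2 + real e)"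
  using assms(2)
proof (induction e)
  case 0
  then show ?case by (simp add: power2_eq_square)
next
  case (Suc d)
  define x where "x = real d"
  have x: "0 \<le> x" "x \<le> m - 1" using Suc.prems by (auto simp: x_def)
  have IH: "m ^ d * (m * (m - x)) \<le> (m - 1) ^ d * (m\<^sup>2 + x)" using Suc by (simp add: x_def)
  have "0 \<le> (x + 1) * (m\<^sup>2 - m + x)"
  proof (rule mult_nonneg_nonneg)
    have "m * 1 \<le> m * m" by (rule mult_left_mono) (use assms in auto)
    then show "0 \<le> m\<^sup>2 - m + x" using x unfolding power2_eq_square by linarith
  qed (use x in simp)
  then have step: "m * (m - x - 1) * (m\<^sup>2 + x) \<le> (m - 1) * (m\<^sup>2 + x + 1) * (m - x)"
    by (simp add: power2_eq_square algebra_simps)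
  have "(m - x) * (m ^ Suc d * (m * (m - x - 1)))
      = (m * (m - x - 1)) * (m ^ d * (m * (m - x)))" by simp
  also have "\<dots> \<le> (m * (m - x - 1)) * ((m - 1) ^ d * (m\<^sup>2 + x))"
    by (rule mult_left_mono[OF IH]) (use x assms in auto)
  also have "\<dots> = (m - 1) ^ d * (m * (m - x - 1) * (m\<^sup>2 + x))" by simp
  also have "\<dots> \<le> (m - 1) ^ d * ((m - 1) * (m\<^sup>2 + x + 1) * (m - x))"
    by (rule mult_left_mono[OF step]) (use assms in auto)
  also have "\<dots> = (m - x) * ((m - 1) ^ Suc d * (m\<^sup>2 + x + 1))" by simp
  finally have "m ^ Suc d * (m * (m - x - 1)) \<le> (m - 1) ^ Suc d * (m\<^sup>2 + x + 1)"
    using x assms by simp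
  then show ?case by (simp add: x_def algebra_simps)
qed

text \<open>This is \<open>accept_opt_ge\<close> with all denominators cleared, as
  \<open>accept_at_opt\<close> and \<open>optimum_scaled\<close> show.\<close>

lemma weight_ineq:
  assumes "m \<ge> 2" "i \<le> 2 * m"
  shows "real i * real m ^ (m + 1) * (real m - 1) ^ m
     \<le> real m ^ i * (real m - 1) ^ (2 * m - i) * (real m * (real m + 1) - real i)"
proof (cases "m \<le> i")
  case True
  then obtain d where d: "i = m + d" using le_Suc_ex by blast
  have "real m ^ m * (real m - 1) ^ (m - d) * ((real m - 1) ^ d * (real m * (real m + real d)))
    \<le> real m ^ m * (real m - 1) ^ (m - d) * (real m ^ d * ((real m)\<^sup>2 - real d))"
    by (intro mult_left_mono weight_ineq_above) (use assms d in auto)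
  moreover have "(real m - 1) ^ m = (real m - 1) ^ (m - d) * (real m - 1) ^ d"
    using assms d by (simp flip: power_add)
  moreover have "2 * m - i = m - d" using d by simp
  ultimately show ?thesis by (simp add: d power_add power2_eq_square algebra_simps)
next
  case False
  then obtain e where e: "m = i + e" using le_Suc_ex nat_le_linear by blast
  have "real m ^ i * (real m - 1) ^ m * (real m ^ e * (real m * (real m - real e)))
    \<le> real m ^ i * (real m - 1) ^ m * ((real m - 1) ^ e * ((real m)\<^sup>2 + real e))"
    by (intro mult_left_mono weight_ineq_below) (use assms e in auto)
  moreover have "real m ^ m = real m ^ i * real m ^ e" using e by (simp flip: power_add)
  moreover have "2 * m - i = m + e" "real m - real e = real i" using e by auto
  moreover from this have "real m * (real m + 1) - real i = (real m)\<^sup>2 + real e"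
    by (simp add: power2_eq_square algebra_simps)
  ultimately show ?thesis by (simp add: power_add mult_ac)
qed

lemma accept_at_opt:
  assumes "m \<ge> 2" "i \<le> 2 * m"
  shows "accept (2 * m) i (real m / (2 * real m - 1)) * (real m * (real m - 1)) * (2 * real m - 1) ^ (2 * m - 1)
    = real m ^ i * (real m - 1) ^ (2 * m - i) * (real m * (real m + 1) - real i)"
proof -
  define n where "n = 2 * real m - 1"
  define P where "P = real m"
  define Q where "Q = real m - 1"
  have pos: "P > 0" "Q > 0" "n > 0" using assms by (auto simp: n_def P_def Q_def)
  have q: "1 - P / n = Q / n" using pos by (simp add: field_simps) (simp add: n_def P_def Q_def)
  define j where "j = 2 * m - i"
  have ij: "real i + real j = 2 * P" "2 * m = i + j" using assms by (auto simp: j_def P_def)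
  have n1: "n ^ (2 * m - 1) * n = n ^ i * n ^ j"
    using assms by (simp flip: power_add power_Suc2 ij(2))
  \<comment> \<open>At \<open>i = 0\<close> the exponent \<open>i - 1\<close> is truncated, but the
    factor \<open>real i\<close> vanishes; likewise for \<open>j\<close>.\<close>
  have a1: "real i * (P / n) ^ (i - 1) * (P / n) = real i * (P / n) ^ i" by (cases i) auto
  have a2: "real j * (Q / n) ^ (j - 1) * (Q / n) = real j * (Q / n) ^ j" by (cases j) auto
  let ?p = "P / n" and ?q = "Q / n"
  \<comment> \<open>The extra factor \<open>?p * ?q\<close> makes every term a multiple of
    \<open>?p ^ i * ?q ^ j\<close>, without negative exponents.\<close>
  have "accept (2 * m) i ?p * (?p * ?q) = ?p ^ i * ?q ^ j * (?p * ?q)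
      + (real i * ?p ^ (i - 1) * ?p) * ?q ^ j * ?q * ?q + (real j * ?q ^ (j - 1) * ?q) * ?p ^ i * ?p * ?p"
    unfolding accept_def q j_def[symmetric] by (simp add: algebra_simps)
  also have "\<dots> = ?p ^ i * ?q ^ j * (?p * ?q + real i * ?q * ?q + real j * ?p * ?p)"
    unfolding a1 a2 by (simp add: algebra_simps)
  also have "?p * ?q + real i * ?q * ?q + real j * ?p * ?p = (P * Q + real i * Q * Q + real j * P * P) / (n * n)"
    by (simp add: add_divide_distrib)
  \<comment> \<open>Substituting \<open>j = 2 P - i\<close> and \<open>Q = P - 1\<close> makes the
    bracket divisible by \<open>n = P + Q\<close>; the quotient is linear in
    \<open>i\<close>.\<close>
  also have "P * Q + real i * Q * Q + real j * P * P = n * (P * (P + 1) - real i)"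
  proof -
    have eqs: "real j = 2 * P - real i" "Q = P - 1" "n = 2 * P - 1"
      using ij by (auto simp: P_def Q_def n_def)
    show ?thesis unfolding eqs by (simp add: algebra_simps)
  qed
  finally have "accept (2 * m) i ?p * (P * Q) * (n ^ i * n ^ j) = P ^ i * Q ^ j * (P * (P + 1) - real i) * n"
    using pos by (simp add: field_simps)
  then have "(accept (2 * m) i ?p * (P * Q) * n ^ (2 * m - 1)) * n = P ^ i * Q ^ j * (P * (P + 1) - real i) * n"
    by (simp add: n1[symmetric] mult_ac)
  then have "accept (2 * m) i ?p * (P * Q) * n ^ (2 * m - 1) = P ^ i * Q ^ j * (P * (P + 1) - real i)"
    using pos by simp
  then show ?thesis by (simp add: P_def Q_def n_def j_def)
qed

text \<open>For \<open>m \<ge> 2\<close> this is the claimed value at \<open>k = 2 m\<close>, see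
  \<open>optimum_eq_alpha'\<close>.\<close>

definition optimum :: "nat \<Rightarrow> real" where
  "optimum m = real m * (real m * (real m - 1) / (2 * real m - 1)\<^sup>2) ^ (m - 1)"

text \<open>The scaling factor is the one in \<open>accept_at_opt\<close>, so that the two sides of
  the estimate can be compared directly.\<close>

lemma optimum_scaled:
  assumes "m \<ge> 2"
  shows "(optimum m * real i / (2 * real m - 1)) * (real m * (real m - 1)) * (2 * real m - 1) ^ (2 * m - 1)
    = real i * real m ^ (m + 1) * (real m - 1) ^ m"
proof -
  define n where "n = 2 * real m - 1"
  have n: "n > 0" using assms by (simp add: n_def)
  obtain l where m: "m = Suc l" using assms by (cases m) auto
  have "n ^ (2 * m - 1) = n ^ (2 * l) * n" by (simp add: m)
  then have "(optimum m * real i / n) * (real m * (real m - 1)) * n ^ (2 * m - 1)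
     = real i * real m ^ (m + 1) * (real m - 1) ^ m"
    using n unfolding optimum_def n_def[symmetric]
    by (simp add: power_divide power_mult[symmetric] power_mult_distrib) (simp add: m)
  then show ?thesis by (simp add: n_def)
qed

lemma accept_opt_ge:
  assumes "m \<ge> 2" "i \<le> 2 * m"
  shows "optimum m * real i / (2 * real m - 1) \<le> accept (2 * m) i (real m / (2 * real m - 1))" (is "?x \<le> ?y")
proof -
  let ?A = "real m * (real m - 1)" and ?B = "(2 * real m - 1) ^ (2 * m - 1)"
  have "?x * ?A * ?B \<le> ?y * ?A * ?B"
    unfolding accept_at_opt[OF assms] optimum_scaled[OF assms(1)] by (rule weight_ineq[OF assms])
  then have "?x * (?A * ?B) \<le> ?y * (?A * ?B)" by (simp only: mult.assoc)
  moreover have "0 < ?A * ?B" using assms by auto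
  ultimately show ?thesis by (rule mult_right_le_imp_le)
qed

text \<open>The factor \<open>m (m + 1) - i\<close> equals \<open>m\<^sup>2\<close> at
  \<open>i = m\<close> and \<open>(m + 1) (m - 1)\<close> at \<open>i = m + 1\<close>; in both cases
  the scaled sides coincide.\<close>

lemma accept_opt_eq:
  assumes "m \<ge> 2" "i = m \<or> i = m + 1"
  shows "accept (2 * m) i (real m / (2 * real m - 1)) = optimum m * real i / (2 * real m - 1)" (is "?y = ?x")
proof -
  let ?A = "real m * (real m - 1)" and ?B = "(2 * real m - 1) ^ (2 * m - 1)"
  have i: "i \<le> 2 * m" using assms by auto
  obtain l where m: "m = Suc l" using assms by (cases m) auto
  have "real m ^ i * (real m - 1) ^ (2 * m - i) * (real m * (real m + 1) - real i)
     = real i * real m ^ (m + 1) * (real m - 1) ^ m"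
    using assms(2)
  proof
    assume "i = m"
    then show ?thesis by (simp add: algebra_simps)
  next
    assume "i = m + 1"
    then show ?thesis by (simp add: m algebra_simps)
  qed
  then have "?y * ?A * ?B = ?x * ?A * ?B"
    unfolding accept_at_opt[OF assms(1) i] optimum_scaled[OF assms(1)] .
  then have "?y * (?A * ?B) = ?x * (?A * ?B)" by (simp only: mult.assoc)
  moreover have "?A * ?B \<noteq> 0" using assms by auto
  ultimately show ?thesis by (metis mult_right_cancel)
qed

section \<open>Maximum of the mixture of the two middle layers over \<open>p\<close>\<close>

text \<open>
  In the variable \<open>x\<close> with \<open>p = (1 + x) / 2\<close>, the function \<open>\<lambda>(D\<^sub>N, p)\<close> is a positive multiple of
  \<open>(1 - x)^(m - 2) (1 + x)^(m - 1) obj_cubic n x\<close>, and the sign of its derivative is that of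
  \<open>(1 - n x) obj_cofactor n x\<close>.
\<close>

definition obj_cubic :: "real \<Rightarrow> real \<Rightarrow> real" where
  "obj_cubic n x = - 2 * n\<^sup>2 * x ^ 3 + (n ^ 3 - 2 * n\<^sup>2 + 5 * n - 2) * x\<^sup>2 - (4 * n\<^sup>2 + 2) * x + (n + 2) * (n\<^sup>2 + 1)"

definition obj_cofactor :: "real \<Rightarrow> real \<Rightarrow> real" where
  "obj_cofactor n x = n * (n - 1)\<^sup>2 - (4 * n\<^sup>2 - 10 * n + 2) * x + (n ^ 3 - 2 * n\<^sup>2 + 5 * n - 4) * x\<^sup>2
     - 2 * n * (n + 1) * x ^ 3"

lemma obj_cofactor_pos:
  fixes n x :: real
  assumes "n \<ge> 3" "-1 < x" "x < 1"
  shows "obj_cofactor n x > 0"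
proof -
  define y where "y = n - 3"
  have n: "n = y + 3" and y: "y \<ge> 0" using assms by (auto simp: y_def)
  have c0: "n * (n - 1)\<^sup>2 > 0" using assms by simp
  show ?thesis
  proof (cases "x \<ge> 0")
    case True
    \<comment> \<open>The coefficient \<open>2 * (n - 1)\<^sup>2 * (n - 3)\<close> is the value at
      \<open>x = 1\<close>. It vanishes for \<open>n = 3\<close>, so strict positivity comes from
      the part with the factor \<open>1 - x\<close>.\<close>
    have "obj_cofactor n x = 2 * (n - 1)\<^sup>2 * (n - 3) * x ^ 3 + (1 - x) * (n * (n - 1)\<^sup>2
       + (((n - 1) * (n - 2) * (n - 3) + 4) * x + (2 * (n - 1)\<^sup>2 * (n - 3) + 2 * n * (n + 1)) * x\<^sup>2))"
      unfolding obj_cofactor_def by (simp add: power2_eq_square power3_eq_cube algebra_simps)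
    also have "\<dots> > 0"
    proof (rule add_nonneg_pos[OF _ mult_pos_pos[OF _ add_pos_nonneg[OF c0]]])
      show "0 \<le> 2 * (n - 1)\<^sup>2 * (n - 3) * x ^ 3" using True assms by simp
      have c: "0 \<le> (n - 1) * (n - 2) * (n - 3) + 4" "0 \<le> 2 * (n - 1)\<^sup>2 * (n - 3) + 2 * n * (n + 1)"
        using assms by (simp_all add: add_nonneg_nonneg)
      show "0 \<le> ((n - 1) * (n - 2) * (n - 3) + 4) * x + (2 * (n - 1)\<^sup>2 * (n - 3) + 2 * n * (n + 1)) * x\<^sup>2"
        by (rule add_nonneg_nonneg[OF mult_nonneg_nonneg[OF c(1) True] mult_nonneg_nonneg[OF c(2)]]) simp
    qed (use assms in simp)
    finally show ?thesis .
  next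
    case False
    define z where "z = - x"
    have z: "z \<ge> 0" "x = - z" using False by (auto simp: z_def)
    \<comment> \<open>In terms of \<open>z = - x\<close> and \<open>y = n - 3\<close> all
      coefficients are nonnegative.\<close>
    have 1: "4 * n\<^sup>2 - 10 * n + 2 = 4 * y\<^sup>2 + 14 * y + 8"
      "n ^ 3 - 2 * n\<^sup>2 + 5 * n - 4 = y ^ 3 + 7 * y\<^sup>2 + 20 * y + 20"
      by (simp_all add: n power2_eq_square power3_eq_cube algebra_simps)
    have "obj_cofactor n x = n * (n - 1)\<^sup>2 + ((4 * y\<^sup>2 + 14 * y + 8) * z + (y ^ 3 + 7 * y\<^sup>2 + 20 * y + 20) * z\<^sup>2
     + 2 * n * (n + 1) * z ^ 3)"
      unfolding obj_cofactor_def 1 z(2) by simp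
    also have "\<dots> > 0"
      by (rule add_pos_nonneg[OF c0]) (use z y n in \<open>intro add_nonneg_nonneg mult_nonneg_nonneg; auto\<close>)
    finally show ?thesis .
  qed
qed

text \<open>Here \<open>l\<close> stands for \<open>m - 2\<close>, so the exponents need no
  subtraction and \<open>n = 2 m - 1\<close> becomes \<open>2 l + 3\<close>.\<close>

definition objective :: "nat \<Rightarrow> real \<Rightarrow> real" where
  "objective l x = (1 - x) ^ l * (1 + x) ^ (l + 1) * obj_cubic (2 * real l + 3) x"

text \<open>Multiplying by \<open>1 - x\<^sup>2\<close>, which is positive on the interval, restores
  the powers lowered by differentiation. What remains beside them is a polynomial of degree four
  that splits off \<open>1 - n x\<close>.\<close>

lemma objective_deriv:
  assumes "-1 < x" "x < 1" "n = 2 * real l + 3"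
  shows "\<exists>D. (objective l has_real_derivative D) (at x) \<and>
    D * (1 - x\<^sup>2) = (1 - x) ^ l * (1 + x) ^ (l + 1) * ((1 - n * x) * obj_cofactor n x)"
proof -
  define c' where "c' = - 6 * n\<^sup>2 * x\<^sup>2 + 2 * (n ^ 3 - 2 * n\<^sup>2 + 5 * n - 2) * x - (4 * n\<^sup>2 + 2)"
  define D1 where "D1 = - (real l * (1 - x) ^ (l - 1))"
  define D2 where "D2 = (real l + 1) * (1 + x) ^ l"
  have d1: "((\<lambda>x. (1 - x) ^ l) has_real_derivative D1) (at x)"
    unfolding D1_def by (auto intro!: derivative_eq_intros)
  have d2: "((\<lambda>x. (1 + x) ^ (l + 1)) has_real_derivative D2) (at x)"
  proof -
    have "((\<lambda>x. 1 + x) has_real_derivative 1) (at x)" by (auto intro!: derivative_eq_intros)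
    from DERIV_power[OF this, of "l + 1"] show ?thesis by (simp add: D2_def add.commute)
  qed
  have d3: "(obj_cubic n has_real_derivative c') (at x)"
    unfolding obj_cubic_def[abs_def] c'_def
    by (auto intro!: derivative_eq_intros simp: algebra_simps)
  let ?D = "(D1 * (1 + x) ^ (l + 1) + D2 * (1 - x) ^ l) * obj_cubic n x + c' * ((1 - x) ^ l * (1 + x) ^ (l + 1))"
  have d: "(objective l has_real_derivative ?D) (at x)"
    unfolding objective_def[abs_def] assms(3)[symmetric] by (rule DERIV_mult[OF DERIV_mult[OF d1 d2] d3])
  have D1: "D1 * (1 - x) = - real l * (1 - x) ^ l" by (cases l) (auto simp: D1_def algebra_simps)
  have D2: "D2 * (1 + x) = (real l + 1) * (1 + x) ^ (l + 1)" by (simp add: D2_def)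
  have l: "real l = (n - 3) / 2" using assms(3) by simp
  have "?D * (1 - x\<^sup>2) = ((D1 * (1 - x)) * (1 + x) * (1 + x) ^ (l + 1)
      + (D2 * (1 + x)) * (1 - x) * (1 - x) ^ l) * obj_cubic n x + c' * (1 - x\<^sup>2) * ((1 - x) ^ l * (1 + x) ^ (l + 1))"
    by (simp add: power2_eq_square algebra_simps)
  also have "\<dots> = (1 - x) ^ l * (1 + x) ^ (l + 1) *
      ((- real l * (1 + x) + (real l + 1) * (1 - x)) * obj_cubic n x + c' * (1 - x\<^sup>2))"
    unfolding D1 D2 by (simp only: algebra_simps)
  \<comment> \<open>The root \<open>1 / n\<close> is the critical point \<open>p = m / n\<close> in
    the variable \<open>x\<close>.\<close>
  also have "(- real l * (1 + x) + (real l + 1) * (1 - x)) * obj_cubic n x + c' * (1 - x\<^sup>2)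
     = (1 - n * x) * obj_cofactor n x"
    unfolding l obj_cubic_def c'_def obj_cofactor_def by (simp add: power2_eq_square power3_eq_cube field_simps)
  finally show ?thesis using d by blast
qed

text \<open>The derivative is positive before \<open>1 / n\<close> and negative after it. Continuity
  extends the comparison to the endpoints -1 and 1, where no sign of the derivative is
  available.\<close>

lemma objective_max:
  assumes "-1 \<le> x" "x \<le> 1"
  shows "objective l x \<le> objective l (1 / (2 * real l + 3))"
proof -
  define n where "n = 2 * real l + 3"
  have n: "n \<ge> 3" by (simp add: n_def)
  have xn: "-1 < 1 / n" "1 / n < 1" using n by (auto intro: order.strict_trans2[of _ 0])
  have cont: "continuous_on S (objective l)" for S
    unfolding objective_def[abs_def] obj_cubic_def by (intro continuous_intros)
  have sgn: "\<exists>D. (objective l has_real_derivative D) (at y) \<and> (n * y < 1 \<longrightarrow> 0 < D) \<and> (1 < n * y \<longrightarrow> D < 0)"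
    if y: "-1 < y" "y < 1" for y
  proof -
    obtain D where D: "(objective l has_real_derivative D) (at y)"
      "D * (1 - y\<^sup>2) = (1 - y) ^ l * (1 + y) ^ (l + 1) * ((1 - n * y) * obj_cofactor n y)"
      using objective_deriv[OF y n_def] by blast
    have y2: "0 < 1 - y\<^sup>2" using y by (simp add: abs_square_less_1)
    have r: "0 < obj_cofactor n y" using obj_cofactor_pos[OF n y] .
    have w: "0 < (1 - y) ^ l * (1 + y) ^ (l + 1)" using y by simp
    have "0 < D" if "n * y < 1"
    proof -
      have "0 < D * (1 - y\<^sup>2)" unfolding D(2)
        by (rule mult_pos_pos[OF w mult_pos_pos[OF _ r]]) (use that in simp)
      then show ?thesis using y2 by (simp only: zero_less_mult_pos2)
    qed
    moreover have "D < 0" if "1 < n * y"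
    proof -
      have "D * (1 - y\<^sup>2) < 0" unfolding D(2)
        by (rule mult_pos_neg[OF w mult_neg_pos[OF _ r]]) (use that in simp)
      then show ?thesis using y2 by (simp add: mult_less_0_iff)
    qed
    ultimately show ?thesis using D by blast
  qed
  consider "x < 1 / n" | "x = 1 / n" | "1 / n < x" by linarith
  then have "objective l x \<le> objective l (1 / n)"
  proof cases
    case 1
    have "objective l x < objective l (1 / n)"
    proof (rule DERIV_pos_imp_increasing_open[OF 1])
      fix y assume "x < y" "y < 1 / n"
      moreover from this have "n * y < 1" using n by (simp add: field_simps)
      ultimately show "\<exists>D. (objective l has_real_derivative D) (at y) \<and> 0 < D"
        using sgn[of y] assms xn by auto
    qed (rule cont)
    then show ?thesis by simp
  next
    case 3
    have "objective l (1 / n) > objective l x"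
    proof (rule DERIV_neg_imp_decreasing_open[OF 3])
      fix y assume "1 / n < y" "y < x"
      moreover from this have "1 < n * y" using n by (simp add: field_simps)
      ultimately show "\<exists>D. (objective l has_real_derivative D) (at y) \<and> D < 0"
        using sgn[of y] assms xn by auto
    qed (rule cont)
    then show ?thesis by simp
  qed simp
  then show ?thesis by (simp add: n_def)
qed

text \<open>The solution of \<open>\<partial>\<lambda>(D\<^sub>N, p) / \<partial>p = 0\<close> at \<open>p = m / (2 m - 1)\<close> for the proportion of layer \<open>m + 1\<close>.\<close>

definition mix_weight :: "nat \<Rightarrow> real" where
  "mix_weight m = (real m - 1)\<^sup>2 * 2 / ((2 * real m - 1)\<^sup>2 + 1)"

text \<open>The factor \<open>4 ^ m\<close> clears the halves in \<open>p\<close> and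
  \<open>1 - p\<close>, and \<open>n\<^sup>2 + 1\<close> clears the denominator of
  \<open>mix_weight\<close>. Both layers share \<open>(p * r) ^ l\<close>, where
  \<open>4 * p * r = 1 - x\<^sup>2\<close>.\<close>

lemma mixture_objective:
  assumes "m = l + 2"
  shows "((1 - mix_weight m) * accept (2 * m) m ((1 + x) / 2) + mix_weight m * accept (2 * m) (m + 1) ((1 + x) / 2))
     * (4 ^ m * ((2 * real m - 1)\<^sup>2 + 1)) = objective l x"
proof -
  define n where "n = 2 * real m - 1"
  have ml: "real m = (n + 1) / 2" "real l = (n - 3) / 2" using assms by (auto simp: n_def)
  have q: "1 - (1 + x) / 2 = (1 - x) / 2" by (simp add: field_simps)
  define N where "N = n\<^sup>2 + 1"
  have N: "N > 0" by (simp add: N_def add_nonneg_pos)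
  have th: "mix_weight m * N = (n - 1)\<^sup>2 / 2" "(1 - mix_weight m) * N = N - (n - 1)\<^sup>2 / 2"
    using N unfolding mix_weight_def n_def[symmetric] N_def[symmetric]
    by (auto simp: ml power2_eq_square field_simps)
  define p where "p = (1 + x) / 2"
  define r where "r = (1 - x) / 2"
  have a1: "accept (2 * m) m p = (p * r) ^ l * ((p * r) ^ 2 + (l + 2) * (p * r) * (r ^ 2 + p ^ 2))"
    unfolding accept_def p_def q r_def[symmetric]
    unfolding p_def[symmetric] assms by (simp add: power_mult_distrib power2_eq_square algebra_simps)
  have a2: "accept (2 * m) (m + 1) p = (p * r) ^ l * (p ^ 3 * r + (l + 3) * (p * r) ^ 2 + (l + 1) * p ^ 4)"
    unfolding accept_def p_def q r_def[symmetric]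
    unfolding p_def[symmetric] assms by (simp add: power_mult_distrib power2_eq_square power3_eq_cube power4_eq_xxxx algebra_simps)
  have "((1 - mix_weight m) * accept (2 * m) m p + mix_weight m * accept (2 * m) (m + 1) p) * (4 ^ m * N)
    = 4 ^ m * ((((1 - mix_weight m) * N) * accept (2 * m) m p + (mix_weight m * N) * accept (2 * m) (m + 1) p))"
    by (simp add: algebra_simps)
  also have "\<dots> = (4 ^ l * (p * r) ^ l) * (16 * ((N - (n - 1)\<^sup>2 / 2) * ((p * r) ^ 2 + (l + 2) * (p * r) * (r ^ 2 + p ^ 2))
      + (n - 1)\<^sup>2 / 2 * (p ^ 3 * r + (l + 3) * (p * r) ^ 2 + (l + 1) * p ^ 4)))"
    unfolding th a1 a2 by (simp add: assms algebra_simps)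
  also have "4 ^ l * (p * r) ^ l = (1 - x) ^ l * (1 + x) ^ l"
  proof -
    have "4 * (p * r) = (1 - x) * (1 + x)" by (simp add: p_def r_def field_simps)
    then show ?thesis unfolding power_mult_distrib[symmetric] by (rule arg_cong)
  qed
  \<comment> \<open>The 16 is \<open>4 ^ m / 4 ^ l\<close>. Both summands are divisible by
    \<open>p\<close>, which yields the factor \<open>1 + x\<close>.\<close>
  also have "16 * ((N - (n - 1)\<^sup>2 / 2) * ((p * r) ^ 2 + (l + 2) * (p * r) * (r ^ 2 + p ^ 2))
      + (n - 1)\<^sup>2 / 2 * (p ^ 3 * r + (l + 3) * (p * r) ^ 2 + (l + 1) * p ^ 4)) = (1 + x) * obj_cubic n x"
    unfolding N_def p_def r_def obj_cubic_def of_nat_add ml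
    by (simp add: power2_eq_square power3_eq_cube power4_eq_xxxx field_simps)
  finally have "((1 - mix_weight m) * accept (2 * m) m p + mix_weight m * accept (2 * m) (m + 1) p) * (4 ^ m * N)
     = (1 - x) ^ l * (1 + x) ^ (l + 1) * obj_cubic n x" by (simp add: mult_ac)
  moreover have "n = 2 * real l + 3" by (simp add: n_def assms)
  ultimately show ?thesis unfolding objective_def p_def N_def by (simp only: n_def)
qed

text \<open>The maximum lies at \<open>p = m / n\<close>, where both layers meet the pointwise bound
  with equality; \<open>m + mix_weight m\<close> is the mean weight of the mixture.\<close>

lemma mixture_le:
  assumes "m \<ge> 2" "0 \<le> p" "p \<le> 1"
  shows "(1 - mix_weight m) * accept (2 * m) m p + mix_weight m * accept (2 * m) (m + 1) p
     \<le> optimum m * (real m + mix_weight m) / (2 * real m - 1)"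
proof -
  obtain l where l: "m = l + 2" using assms(1) by (metis add.commute le_Suc_ex)
  let ?g = "\<lambda>p. (1 - mix_weight m) * accept (2 * m) m p + mix_weight m * accept (2 * m) (m + 1) p"
  have pos: "0 < 4 ^ m * ((2 * real m - 1)\<^sup>2 + 1)" by (simp add: add_nonneg_pos)
  have "?g ((1 + (2 * p - 1)) / 2) * (4 ^ m * ((2 * real m - 1)\<^sup>2 + 1))
     \<le> ?g ((1 + 1 / (2 * real l + 3)) / 2) * (4 ^ m * ((2 * real m - 1)\<^sup>2 + 1))"
    unfolding mixture_objective[OF l] by (rule objective_max) (use assms in auto)
  then have "?g ((1 + (2 * p - 1)) / 2) \<le> ?g ((1 + 1 / (2 * real l + 3)) / 2)"
    using pos by (simp only: mult_le_cancel_right_pos)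
  also have "(1 + 1 / (2 * real l + 3)) / 2 = real m / (2 * real m - 1)"
    by (simp add: l field_simps)
  also have "?g \<dots> = optimum m * (real m + mix_weight m) / (2 * real m - 1)"
    using accept_opt_eq[OF assms(1)] by (simp add: field_simps add_divide_distrib[symmetric])
  finally show ?thesis by simp
qed

section \<open>Estimates for \<open>beta\<close> and \<open>gamma\<close>\<close>

lemma expectation_cube_mono:
  fixes f g :: "(nat \<Rightarrow> int) \<Rightarrow> real"
  assumes "set_pmf D \<subseteq> cube k" "\<And>a. a \<in> cube k \<Longrightarrow> f a \<le> g a"
  shows "measure_pmf.expectation D f \<le> measure_pmf.expectation D g"
  unfolding expectation_cube[OF assms(1)] by (intro sum_mono mult_right_mono assms(2) pmf_nonneg)

lemma lam_le_beta:
  assumes "0 \<le> p" "p \<le> 1"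
  shows "lam k (Th t k) D p \<le> beta k (Th t k) D"
  unfolding beta_def
proof (rule cSUP_upper)
  \<comment> \<open>Boundedness is what makes the real-valued \<open>SUP\<close> an upper
    bound.\<close>
  have "lam k (Th t k) D q \<le> 1" for q
    unfolding lam_def
    by (intro measure_pmf.integral_le_const measure_pmf.integrable_const_bound[where B = 1])
       (auto simp: Th_def sym_fun_def)
  then show "bdd_above (lam k (Th t k) D ` {0..1})" by (intro bdd_aboveI[where M = 1]) auto
qed (use assms in auto)

lemma gamma_Th:
  assumes "set_pmf D \<subseteq> cube k" "0 < k"
  shows "gamma k (Th (k - 1) k) D = measure_pmf.expectation D (\<lambda>a. if k - 1 \<le> wt k a then 1 else 0)"
  unfolding gamma_def using assms by (simp only: lam_Th accept_1 wt_le)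

text \<open>Markov's inequality: \<open>k - 1\<close> times the indicator of weight at least
  \<open>k - 1\<close> is at most the weight.\<close>

lemma gamma_le_expected_wt:
  assumes "set_pmf D \<subseteq> cube k" "0 < k"
  shows "real (k - 1) * gamma k (Th (k - 1) k) D \<le> measure_pmf.expectation D (\<lambda>a. real (wt k a))"
proof -
  have "real (k - 1) * gamma k (Th (k - 1) k) D
      = measure_pmf.expectation D (\<lambda>a. real (k - 1) * (if k - 1 \<le> wt k a then 1 else 0))"
    by (simp only: gamma_Th[OF assms] Bochner_Integration.integral_mult_right_zero)
  also have "\<dots> \<le> measure_pmf.expectation D (\<lambda>a. real (wt k a))"
    by (rule expectation_cube_mono[OF assms(1)]) auto
  finally show ?thesis .
qed

section \<open>Mixtures of two uniform layers\<close>

definition layer :: "nat \<Rightarrow> nat \<Rightarrow> (nat \<Rightarrow> int) set" where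
  "layer k i = {x \<in> cube k. wt k x = i}"

lemma finite_layer [simp]: "finite (layer k i)"
  using finite_cube by (simp add: layer_def)

lemma layer_nonempty:
  assumes "i \<le> k"
  shows "layer k i \<noteq> {}"
proof -
  let ?x = "\<lambda>l\<in>{1..k}. if l \<le> i then 1 else - 1 :: int"
  have "{l \<in> {1..k}. ?x l = 1} = {1..i}" using assms by auto
  then have "wt k ?x = i" by (simp add: wt_def)
  moreover have "?x \<in> cube k" by (auto simp: cube_def)
  ultimately show ?thesis by (auto simp: layer_def)
qed

definition two_layers :: "nat \<Rightarrow> real \<Rightarrow> nat \<Rightarrow> nat \<Rightarrow> (nat \<Rightarrow> int) pmf" where
  "two_layers k t i j = bernoulli_pmf t \<bind> (\<lambda>c. pmf_of_set (layer k (if c then i else j)))"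

lemma two_layers_sym:
  assumes "i \<le> k" "j \<le> k"
  shows "two_layers k t i j \<in> sym_dists k"
proof -
  have ne: "layer k (if c then i else j) \<noteq> {}" for c using layer_nonempty assms by auto
  have "set_pmf (two_layers k t i j) \<subseteq> cube k"
  proof
    fix x assume "x \<in> set_pmf (two_layers k t i j)"
    then obtain c where "x \<in> set_pmf (pmf_of_set (layer k (if c then i else j)))"
      unfolding two_layers_def set_bind_pmf by blast
    then have "x \<in> layer k (if c then i else j)" by (simp only: set_pmf_of_set[OF ne finite_layer])
    then show "x \<in> cube k" by (simp add: layer_def)
  qed
  moreover have "pmf (two_layers k t i j) x = pmf (two_layers k t i j) y"
    if "x \<in> cube k" "y \<in> cube k" "wt k x = wt k y" for x y
  proof -
    have "indicator (layer k l) x = (indicator (layer k l) y :: real)" for l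
      using that by (auto simp: layer_def indicator_def)
    then show ?thesis by (simp add: two_layers_def pmf_bind ne)
  qed
  ultimately show ?thesis unfolding sym_dists_def by blast
qed

lemma expectation_two_layers:
  fixes g :: "nat \<Rightarrow> real"
  assumes "i \<le> k" "j \<le> k" "0 \<le> t" "t \<le> 1"
  shows "measure_pmf.expectation (two_layers k t i j) (\<lambda>a. g (wt k a)) = t * g i + (1 - t) * g j"
proof -
  have ne: "layer k (if c then i else j) \<noteq> {}" for c using layer_nonempty assms by auto
  have lay: "measure_pmf.expectation (pmf_of_set (layer k l)) (\<lambda>a. g (wt k a)) = g l" if "l \<le> k" for l
  proof -
    have "(\<Sum>a\<in>layer k l. g (wt k a)) = (\<Sum>a\<in>layer k l. g l)"
      by (rule sum.cong) (auto simp: layer_def)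
    then show ?thesis
      using layer_nonempty[OF that] by (simp add: integral_pmf_of_set)
  qed
  show ?thesis
    unfolding two_layers_def
    by (subst pmf_expectation_bind[where A = UNIV])
       (use assms ne in \<open>auto simp: lay UNIV_bool set_pmf_of_set[OF ne]\<close>)
qed

section \<open>The closed form and the two bounds on the ratio\<close>

lemma optimum_eq_alpha':
  assumes "m \<ge> 2"
  shows "real (2 * m) / 2 * alpha' (2 * m - 1) = optimum m"
proof -
  have r: "real (2 * m - 1) = 2 * real m - 1" using assms by (simp add: of_nat_diff)
  have e: "(2 * m - 1 - 1) div 2 = m - 1" by simp
  have "(2 * real m - 1 - 1) * (2 * real m - 1 + 1) / (4 * (2 * real m - 1)\<^sup>2)
      = real m * (real m - 1) / (2 * real m - 1)\<^sup>2"
  proof -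
    have "(2 * real m - 1 - 1) * (2 * real m - 1 + 1) = 4 * (real m * (real m - 1))"
      by (simp add: algebra_simps)
    then show ?thesis by (simp only: mult_divide_mult_cancel_left_if) simp
  qed
  then show ?thesis unfolding alpha'_def optimum_def r e by simp
qed

lemma mix_weight_bounds: "0 \<le> mix_weight m" "mix_weight m \<le> 1"
proof -
  have 0: "0 < (2 * real m - 1)\<^sup>2 + 1" by (simp add: add_nonneg_pos)
  then show "0 \<le> mix_weight m" by (simp add: mix_weight_def)
  \<comment> \<open>This is the difference of the two sides of the next inequality.\<close>
  have "0 \<le> 2 * (real m)\<^sup>2" by simp
  then have "(real m - 1)\<^sup>2 * 2 \<le> (2 * real m - 1)\<^sup>2 + 1" by (simp add: power2_eq_square algebra_simps)
  then show "mix_weight m \<le> 1" using 0 by (simp add: mix_weight_def)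
qed

lemma optimum_le_ratio:
  assumes "m \<ge> 2" "DN \<in> sym_dists (2 * m)" "DY \<in> sym_dists (2 * m)" "mu DN = mu DY"
  shows "ereal (optimum m) \<le> ratio (2 * m) (Th (2 * m - 1) (2 * m)) DN DY"
proof -
  let ?k = "2 * m" and ?n = "2 * real m - 1" and ?f = "Th (2 * m - 1) (2 * m)"
  let ?E = "\<lambda>D. measure_pmf.expectation D (\<lambda>a. real (wt ?k a))"
  have k: "0 < ?k" using assms(1) by simp
  have n: "0 < ?n" "real (?k - 1) = ?n" using assms(1) by (auto simp: of_nat_diff)
  have sub: "set_pmf DN \<subseteq> cube ?k" "set_pmf DY \<subseteq> cube ?k"
    using assms(2,3) by (auto simp: sym_dists_def)
  have v: "0 \<le> optimum m" using assms(1) by (simp add: optimum_def)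
  have EE: "?E DN = ?E DY" using mu_eq[OF assms(2) k] mu_eq[OF assms(3) k] assms(4) by simp
  have p: "0 \<le> real m / ?n" "real m / ?n \<le> 1" using assms(1) n by auto
  \<comment> \<open>Markov's inequality bounds \<open>gamma\<close> by the expected weight of
    \<open>DY\<close>, which is that of \<open>DN\<close>; the pointwise estimate then leads to
    \<open>lam\<close> at \<open>p = m / n\<close>, hence to \<open>beta\<close>.\<close>
  have "optimum m * gamma ?k ?f DY = optimum m / ?n * (?n * gamma ?k ?f DY)" using n by simp
  also have "\<dots> \<le> optimum m / ?n * ?E DN"
    unfolding EE by (rule mult_left_mono) (use gamma_le_expected_wt[OF sub(2) k] n v in auto)
  also have "\<dots> = measure_pmf.expectation DN (\<lambda>a. optimum m / ?n * real (wt ?k a))" by simp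
  also have "\<dots> \<le> measure_pmf.expectation DN (\<lambda>a. accept ?k (wt ?k a) (real m / ?n))"
    by (rule expectation_cube_mono[OF sub(1)])
       (use accept_opt_ge[OF assms(1) wt_le] in simp)
  also have "\<dots> \<le> beta ?k ?f DN"
    unfolding lam_Th[OF sub(1) p, symmetric] by (rule lam_le_beta[OF p])
  finally have le: "optimum m * gamma ?k ?f DY \<le> beta ?k ?f DN" .
  \<comment> \<open>If \<open>gamma\<close> is 0 the ratio is infinite; otherwise it is positive and
    can be divided by.\<close>
  have "0 \<le> gamma ?k ?f DY" unfolding gamma_Th[OF sub(2) k] by (rule Bochner_Integration.integral_nonneg) simp
  then show ?thesis
    using le by (auto simp: ratio_def pos_le_divide_eq)
qed

lemma ratio_le_optimum:
  assumes "m \<ge> 2"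
  obtains DN DY where "DN \<in> sym_dists (2 * m)" "DY \<in> sym_dists (2 * m)" "mu DN = mu DY"
    "ratio (2 * m) (Th (2 * m - 1) (2 * m)) DN DY \<le> ereal (optimum m)"
proof -
  let ?k = "2 * m" and ?n = "2 * real m - 1" and ?f = "Th (2 * m - 1) (2 * m)"
  have k: "0 < ?k" using assms by simp
  have n: "0 < ?n" "real (?k - 1) = ?n" using assms by (auto simp: of_nat_diff)
  \<comment> \<open>With this mass on layer \<open>k - 1\<close> and the rest on layer 0,
    \<open>DY\<close> has mean weight \<open>y * n\<close>, equal to the mean weight
    \<open>m + mix_weight m\<close> of \<open>DN\<close>. That \<open>y \<le> 1\<close> follows from
    \<open>m + 1 \<le> 2 m - 1\<close>.\<close>
  define y where "y = (real m + mix_weight m) / ?n"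
  have y: "0 < y" "y \<le> 1" using mix_weight_bounds[of m] n assms by (auto simp: y_def)
  define DN where "DN = two_layers ?k (mix_weight m) (m + 1) m"
  define DY where "DY = two_layers ?k y (?k - 1) 0"
  have le: "m + 1 \<le> ?k" "m \<le> ?k" "?k - 1 \<le> ?k" "0 \<le> ?k" using assms by auto
  note EN = expectation_two_layers[OF le(1,2) mix_weight_bounds[of m], folded DN_def]
  note EY = expectation_two_layers[OF le(3,4) less_imp_le[OF y(1)] y(2), folded DY_def]
  have sym: "DN \<in> sym_dists ?k" "DY \<in> sym_dists ?k"
    unfolding DN_def DY_def by (intro two_layers_sym le)+
  then have sub: "set_pmf DN \<subseteq> cube ?k" "set_pmf DY \<subseteq> cube ?k" by (auto simp: sym_dists_def)
  have "measure_pmf.expectation DN (\<lambda>a. real (wt ?k a)) = measure_pmf.expectation DY (\<lambda>a. real (wt ?k a))"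
  proof -
    have "y * ?n = real m + mix_weight m" using n(1) by (simp add: y_def)
    then show ?thesis unfolding EN EY n(2) by (simp add: algebra_simps)
  qed
  then have "real ?k * mu DN = real ?k * mu DY"
    unfolding mu_eq[OF sym(1) k] mu_eq[OF sym(2) k] by simp
  then have mu: "mu DN = mu DY" using k by simp
  have gam: "gamma ?k ?f DY = y"
    unfolding gamma_Th[OF sub(2) k] EY[of "\<lambda>w. if ?k - 1 \<le> w then 1 else 0"] using assms by simp
  have "beta ?k ?f DN \<le> optimum m * y"
    unfolding beta_def
  proof (rule cSUP_least)
    fix p :: real assume "p \<in> {0..1}"
    then have p: "0 \<le> p" "p \<le> 1" by auto
    have "lam ?k ?f DN p = (1 - mix_weight m) * accept ?k m p + mix_weight m * accept ?k (m + 1) p"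
      unfolding lam_Th[OF sub(1) p] EN[of "\<lambda>i. accept ?k i p"] by simp
    also have "\<dots> \<le> optimum m * y"
      using mixture_le[OF assms p] by (simp add: y_def)
    finally show "lam ?k ?f DN p \<le> optimum m * y" .
  qed simp
  then have "ratio ?k ?f DN DY \<le> ereal (optimum m)"
    using y unfolding ratio_def gam by (simp add: pos_divide_le_eq)
  then show thesis using that sym mu by blast
qed

theorem theorem1p4:
  fixes k :: nat
  assumes "even k" and "k > 2"
  shows "alpha k (Th (k - 1) k) = ereal (real k / 2 * alpha' (k - 1))"
proof -
  obtain m where k: "k = 2 * m" using assms(1) by (elim evenE)
  then have m: "m \<ge> 2" using assms(2) by simp
  obtain DN DY where D: "DN \<in> sym_dists (2 * m)" "DY \<in> sym_dists (2 * m)" "mu DN = mu DY"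
    "ratio (2 * m) (Th (2 * m - 1) (2 * m)) DN DY \<le> ereal (optimum m)"
    using ratio_le_optimum[OF m] .
  have "alpha (2 * m) (Th (2 * m - 1) (2 * m)) = ereal (optimum m)"
    unfolding alpha_def
  \<comment> \<open>The lower bound holds for every admissible pair, and the pair
    \<open>(DN, DY)\<close> attains it.\<close>
  proof (rule antisym)
    show "ereal (optimum m) \<le> (INF (DN, DY)\<in>{(DN, DY). DN \<in> sym_dists (2 * m) \<and> DY \<in> sym_dists (2 * m) \<and> mu DN = mu DY}.
        ratio (2 * m) (Th (2 * m - 1) (2 * m)) DN DY)"
      by (rule INF_greatest, clarify, rule optimum_le_ratio[OF m])
    show "(INF (DN, DY)\<in>{(DN, DY). DN \<in> sym_dists (2 * m) \<and> DY \<in> sym_dists (2 * m) \<and> mu DN = mu DY}.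
        ratio (2 * m) (Th (2 * m - 1) (2 * m)) DN DY) \<le> ereal (optimum m)"
      by (rule INF_lower2[of "(DN, DY)"]) (use D in auto)
  qed
  then show ?thesis unfolding k by (simp only: optimum_eq_alpha'[OF m])
qed

end
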